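(* For every numerical semigroup $S$, $P(S)\geq 2^{\kappa(S)}$, where $P(S)$ is the number of numerical sets $T$ with $A(T)=S$ and $\kappa(S)$ is the number of connected components of the pseudo-Frobenius graph $GPF(S)$.
   Context: A numerical set $T$ is a subset of $\mathbb{N}_0=\{0,1,2,\dots\}$ containing $0$ with finite complement; elements of $\mathbb{N}_0\setminus T$ are its gaps, and its Frobenius number $F(T)$ is the largest gap (defined when $T\ne\mathbb{N}_0$, so here $S\neq\mathbb{N}_0$). A numerical semigroup is a numerical set closed under addition. The atom monoid of $T$ is $A(T)=\{x\in\mathbb{N}_0 \mid x+T\subseteq T\}$. The pseudo-Frobenius numbers of $S$ are $PF(S)=\{P\in \mathbb{N}_0\setminus S \mid P+s\in S \text{ for all } s\in S\setminus\{0\}\}$. The pseudo-Frobenius graph $GPF(S)$ is the graph with vertex set $PF(S)\setminus\{F(S)\}$ that has an edge between $P$ and $Q$ (possibly $P=Q$, giving a loop) if and only if $P+Q-F(S)\in S$. The empty graph has $0$ connected components. *)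

theory Defs
  imports Main
begin

definition numerical_set :: "nat set \<Rightarrow> bool" where
  "numerical_set T \<longleftrightarrow> 0 \<in> T \<and> finite (UNIV - T)"

definition numerical_semigroup :: "nat set \<Rightarrow> bool" where
  "numerical_semigroup S \<longleftrightarrow> numerical_set S \<and> (\<forall>x\<in>S. \<forall>y\<in>S. x + y \<in> S)"

(* Meaningful only for a numerical set T \<noteq> UNIV, when the set of gaps is finite and nonempty. *)
definition frobenius_number :: "nat set \<Rightarrow> nat" where
  "frobenius_number T = Max (UNIV - T)"

definition atom_monoid :: "nat set \<Rightarrow> nat set" where
  "atom_monoid T = {x. (\<lambda>t. x + t) ` T \<subseteq> T}"

definition pseudo_frobenius :: "nat set \<Rightarrow> nat set" where
  "pseudo_frobenius S = {P. P \<notin> S \<and> (\<forall>s\<in>S - {0}. P + s \<in> S)}"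

definition GPF_verts :: "nat set \<Rightarrow> nat set" where
  "GPF_verts S = pseudo_frobenius S - {frobenius_number S}"

(* The undirected graph is encoded by its symmetric adjacency relation; a loop is a pair (P, P).
   P + Q - F(S) is computed in the integers, since subtraction on nat truncates at 0. *)
definition GPF_edges :: "nat set \<Rightarrow> (nat \<times> nat) set" where
  "GPF_edges S = {(P, Q). P \<in> GPF_verts S \<and> Q \<in> GPF_verts S \<and>
     int P + int Q - int (frobenius_number S) \<in> int ` S}"

(* Vertex sets of the connected components of the graph (V, E), E symmetric: the classes of V
   under "joined by a path", where paths of length 0 are allowed. *)
definition connected_components :: "'a set \<Rightarrow> ('a \<times> 'a) set \<Rightarrow> 'a set set" where
  "connected_components V E = V // {(u, v). u \<in> V \<and> v \<in> V \<and> (u, v) \<in> E\<^sup>*}"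

lemma sym_GPF_edges: "sym (GPF_edges S)"
  by (auto simp: sym_def GPF_edges_def add.commute)

lemma equiv_connected:
  assumes "sym E"
  shows "equiv V {(u, v). u \<in> V \<and> v \<in> V \<and> (u, v) \<in> E\<^sup>*}"
  using sym_rtrancl[OF assms]
  by (auto simp: equiv_def refl_on_def sym_def trans_def)

(* This cardinality is of a finite set: PF(S) consists of gaps of S. *)
definition kappa :: "nat set \<Rightarrow> nat" where
  "kappa S = card (connected_components (GPF_verts S) (GPF_edges S))"

lemma finite_connected_components:
  assumes "numerical_set S"
  shows "finite (connected_components (GPF_verts S) (GPF_edges S))"
proof -
  have "GPF_verts S \<subseteq> UNIV - S"
    by (auto simp: GPF_verts_def pseudo_frobenius_def)
  then have "finite (GPF_verts S)"
    using assms by (auto simp: numerical_set_def intro: finite_subset)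
  then show ?thesis
    unfolding connected_components_def quotient_def by simp
qed

definition numerical_sets_of :: "nat set \<Rightarrow> nat set set" where
  "numerical_sets_of S = {T. numerical_set T \<and> atom_monoid T = S}"

lemma finite_numerical_sets_of:
  assumes "numerical_set S"
  shows "finite (numerical_sets_of S)"
proof (rule finite_subset)
  show "numerical_sets_of S \<subseteq> (\<lambda>G. UNIV - G) ` Pow (UNIV - S)"
  proof
    fix T assume "T \<in> numerical_sets_of S"
    then have "S \<subseteq> T"
      by (force simp: numerical_sets_of_def numerical_set_def atom_monoid_def)
    then show "T \<in> (\<lambda>G. UNIV - G) ` Pow (UNIV - S)"
      by (intro image_eqI[of _ _ "UNIV - T"]) auto
  qed
  show "finite ((\<lambda>G. UNIV - G) ` Pow (UNIV - S))"
    using assms by (simp add: numerical_set_def)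
qed

definition num_sets_of :: "nat set \<Rightarrow> nat" where
  "num_sets_of S = card (numerical_sets_of S)"

end

theory Submission
  imports Defs
begin

text \<open>
  For a set \<open>C\<close> of vertices of the pseudo-Frobenius graph, let \<open>T\<close> consist of those \<open>x\<close> for which
  every pseudo-Frobenius number in \<open>x + S\<close> lies in \<open>C\<close>. Then \<open>S \<subseteq> T\<close>, \<open>S + T \<subseteq> T\<close>, \<open>F(S) \<notin> T\<close>, and
  \<open>C\<close> is recovered as the set of pseudo-Frobenius numbers in \<open>T\<close>. Suppose \<open>C\<close> is a union of
  components. If \<open>P \<in> C\<close> then \<open>F(S) - P \<in> T\<close>, because each pseudo-Frobenius number in
  \<open>F(S) - P + S\<close> is adjacent to \<open>P\<close>. For \<open>x \<in> T - S\<close> pick \<open>s \<in> S\<close> such that \<open>P = x + s\<close> is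
  pseudo-Frobenius: then \<open>s + F(S) - P \<in> T\<close>, and adding it to \<open>x\<close> gives \<open>F(S) \<notin> T\<close>, so \<open>x\<close> is
  not in the atom monoid of \<open>T\<close>. Hence \<open>A(T) = S\<close>, and distinct sets of components give distinct \<open>T\<close>.
\<close>

lemma frobenius_number_notin:
  assumes "numerical_set S" "S \<noteq> UNIV"
  shows "frobenius_number S \<notin> S"
  using Max_in[of "UNIV - S"] assms by (auto simp: numerical_set_def frobenius_number_def)

lemma le_frobenius_number:
  assumes "numerical_set S" "x \<notin> S"
  shows "x \<le> frobenius_number S"
  using assms by (auto simp: numerical_set_def frobenius_number_def intro: Max_ge)

lemma frobenius_number_pseudo_frobenius:
  assumes "numerical_set S" "S \<noteq> UNIV"
  shows "frobenius_number S \<in> pseudo_frobenius S"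
proof -
  have "frobenius_number S + t \<in> S" if "t \<in> S - {0}" for t
    using le_frobenius_number[OF assms(1), of "frobenius_number S + t"] that by auto
  with frobenius_number_notin[OF assms] show ?thesis
    by (simp add: pseudo_frobenius_def)
qed

text \<open>Take the largest \<open>s\<close> in \<open>S\<close> for which \<open>x + s\<close> is
  still a gap: 0 is a candidate, and gaps are bounded by the Frobenius number. For nonzero
  \<open>t\<close> in \<open>S\<close>, the larger element \<open>s + t\<close> of \<open>S\<close>
  is no longer a candidate.\<close>

lemma gap_le_pseudo_frobenius:
  assumes S: "numerical_semigroup S" and x: "x \<notin> S"
  obtains s where "s \<in> S" "x + s \<in> pseudo_frobenius S"
proof -
  let ?G = "{s \<in> S. x + s \<notin> S}"
  have nset: "numerical_set S" and add: "\<And>a b. a \<in> S \<Longrightarrow> b \<in> S \<Longrightarrow> a + b \<in> S"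
    using S by (auto simp: numerical_semigroup_def)
  have "?G \<subseteq> {..frobenius_number S}"
  proof
    fix s assume "s \<in> ?G"
    then show "s \<in> {..frobenius_number S}"
      using le_frobenius_number[OF nset, of "x + s"] by simp
  qed
  then have fin: "finite ?G"
    by (rule finite_subset) simp
  have "0 \<in> ?G"
    using x nset by (simp add: numerical_set_def)
  then have m: "Max ?G \<in> ?G"
    using fin Max_in by blast
  have "x + Max ?G + t \<in> S" if t: "t \<in> S - {0}" for t
  proof (rule ccontr)
    assume "x + Max ?G + t \<notin> S"
    then have "Max ?G + t \<in> ?G"
      using m t add by (auto simp: add.assoc)
    then have "Max ?G + t \<le> Max ?G"
      using fin Max_ge by blast
    with t show False by simp
  qed
  with m have "x + Max ?G \<in> pseudo_frobenius S"
    by (simp add: pseudo_frobenius_def)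
  with m that show ?thesis by blast
qed

text \<open>When y counts as above x if y = x + s with s \<in> \<open>S\<close>, this is the
  complement of the down-set generated by \<open>pseudo_frobenius S - C\<close>.\<close>

definition pf_extension :: "nat set \<Rightarrow> nat set \<Rightarrow> nat set" where
  "pf_extension S C = {x. \<forall>s\<in>S. x + s \<in> pseudo_frobenius S \<longrightarrow> x + s \<in> C}"

lemma pf_extension_superset:
  assumes "numerical_semigroup S"
  shows "S \<subseteq> pf_extension S C"
  using assms by (auto simp: pf_extension_def numerical_semigroup_def pseudo_frobenius_def)

lemma pf_extension_add:
  assumes "numerical_semigroup S" "s \<in> S" "x \<in> pf_extension S C"
  shows "s + x \<in> pf_extension S C"
proof -
  have "s + x + t \<in> C" if "t \<in> S" "s + x + t \<in> pseudo_frobenius S" for t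
  proof -
    have "s + t \<in> S"
      using assms that by (simp add: numerical_semigroup_def)
    moreover have "s + x + t = x + (s + t)"
      by simp
    ultimately show ?thesis
      using assms(3) that(2) by (metis (mono_tags, lifting) mem_Collect_eq pf_extension_def)
  qed
  then show ?thesis
    by (simp add: pf_extension_def)
qed

text \<open>Two distinct pseudo-Frobenius numbers never differ by an element of \<open>S\<close>, so
  for \<open>x\<close> in \<open>C\<close> only \<open>s = 0\<close> tests membership.\<close>

lemma pf_extension_Int_pseudo_frobenius:
  assumes "numerical_set S" "C \<subseteq> pseudo_frobenius S"
  shows "pf_extension S C \<inter> pseudo_frobenius S = C"
proof
  have "0 \<in> S"
    using assms(1) by (simp add: numerical_set_def)
  then show "pf_extension S C \<inter> pseudo_frobenius S \<subseteq> C"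
    by (force simp: pf_extension_def)
  have "s = 0" if "x \<in> C" "s \<in> S" "x + s \<in> pseudo_frobenius S" for x s
    using assms(2) that by (auto simp: pseudo_frobenius_def)
  then show "C \<subseteq> pf_extension S C \<inter> pseudo_frobenius S"
    using assms(2) by (fastforce simp: pf_extension_def)
qed

lemma atom_monoid_pf_extension:
  assumes S: "numerical_semigroup S" "S \<noteq> UNIV"
    and C: "C \<subseteq> GPF_verts S"
    and closed: "\<And>P Q. P \<in> C \<Longrightarrow> (P, Q) \<in> GPF_edges S \<Longrightarrow> Q \<in> C"
  shows "atom_monoid (pf_extension S C) = S"
proof
  let ?F = "frobenius_number S" and ?T = "pf_extension S C"
  have nset: "numerical_set S"
    using S by (simp add: numerical_semigroup_def)
  have "C \<subseteq> pseudo_frobenius S"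
    using C by (auto simp: GPF_verts_def)
  then have TC: "?T \<inter> pseudo_frobenius S = C"
    by (rule pf_extension_Int_pseudo_frobenius[OF nset])
  have FT: "?F \<notin> ?T"
    using TC C frobenius_number_pseudo_frobenius[OF nset S(2)] by (auto simp: GPF_verts_def)
  have reflect: "?F - P \<in> ?T" if P: "P \<in> C" for P
  proof -
    have PV: "P \<in> GPF_verts S" and PS: "P \<notin> S"
      using C P by (auto simp: GPF_verts_def pseudo_frobenius_def)
    have le: "P \<le> ?F"
      using le_frobenius_number[OF nset PS] .
    have "?F - P + u \<in> C" if u: "u \<in> S" "?F - P + u \<in> pseudo_frobenius S" for u
    proof -
      \<comment> \<open>Equality would force \<open>u = P\<close>, but \<open>u\<close> lies in
        \<open>S\<close> and \<open>P\<close> is a gap.\<close>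
      have "?F - P + u \<noteq> ?F"
        using le u(1) PS by (cases "u = P") auto
      then have "?F - P + u \<in> GPF_verts S"
        using u by (simp add: GPF_verts_def)
      moreover have "int P + int (?F - P + u) - int ?F = int u"
        using le by simp
      ultimately have "(P, ?F - P + u) \<in> GPF_edges S"
        using PV u(1) by (simp add: GPF_edges_def)
      with closed P show ?thesis by blast
    qed
    then show ?thesis
      by (simp add: pf_extension_def)
  qed
  show "S \<subseteq> atom_monoid ?T"
    using pf_extension_add[OF S(1)] by (auto simp: atom_monoid_def)
  show "atom_monoid ?T \<subseteq> S"
  proof
    fix x assume x: "x \<in> atom_monoid ?T"
    have "0 \<in> ?T"
      using nset pf_extension_superset[OF S(1)] by (auto simp: numerical_set_def)
    then have xT: "x \<in> ?T"
      using x by (force simp: atom_monoid_def)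
    show "x \<in> S"
    proof (rule ccontr)
      assume "x \<notin> S"
      then obtain s where s: "s \<in> S" "x + s \<in> pseudo_frobenius S"
        using gap_le_pseudo_frobenius[OF S(1)] by blast
      have "x + s \<in> C"
        using xT s by (simp add: pf_extension_def)
      then have "s + (?F - (x + s)) \<in> ?T"
        using pf_extension_add[OF S(1) s(1)] reflect by blast
      then have "x + (s + (?F - (x + s))) \<in> ?T"
        using x by (auto simp: atom_monoid_def)
      \<comment> \<open>\<open>x + s\<close> is a gap, so the natural subtraction from
        \<open>?F\<close> does not truncate.\<close>
      moreover have "x + s \<le> ?F"
        using s(2) le_frobenius_number[OF nset] by (simp add: pseudo_frobenius_def)
      then have "x + (s + (?F - (x + s))) = ?F"
        by simp
      ultimately show False
        using FT by simp
    qed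
  qed
qed

text \<open>Classes are nonempty and pairwise disjoint: a point of a class \<open>X\<close> in
  \<open>K\<close> lies in some class of \<open>L\<close>, which must then be \<open>X\<close>
  itself.\<close>

lemma inj_on_Union_quotient:
  assumes "equiv A r"
  shows "inj_on Union (Pow (A // r))"
proof -
  have "K \<subseteq> L" if K: "K \<subseteq> A // r" and L: "L \<subseteq> A // r" and eq: "\<Union>K = \<Union>L" for K L
  proof
    fix X assume X: "X \<in> K"
    then have XQ: "X \<in> A // r"
      using K by blast
    then obtain a where a: "a \<in> X"
      using in_quotient_imp_non_empty[OF assms] by blast
    then obtain Y where Y: "Y \<in> L" "a \<in> Y"
      using X eq by blast
    then have "X = Y"
      using quotient_disj[OF assms XQ, of Y] L a by blast
    with Y show "X \<in> L" by simp
  qed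
  then show ?thesis
    by (intro inj_onI subset_antisym) simp_all
qed

text \<open>The edge from \<open>P\<close> to \<open>Q\<close> extends a path that reaches
  \<open>P\<close> from a representative of its component.\<close>

lemma Union_connected_components_closed:
  assumes "K \<subseteq> connected_components V E" "P \<in> \<Union>K" "(P, Q) \<in> E" "Q \<in> V"
  shows "Q \<in> \<Union>K"
proof -
  obtain X where X: "X \<in> K" "P \<in> X"
    using assms(2) by blast
  then obtain a where "X = {(u, v). u \<in> V \<and> v \<in> V \<and> (u, v) \<in> E\<^sup>*} `` {a}"
    using assms(1) unfolding connected_components_def by (blast elim: quotientE)
  with X(2) assms(3,4) have "Q \<in> X"
    by (auto intro: rtrancl_into_rtrancl)
  with X(1) show ?thesis by blast
qed

theorem corollary3p7:
  fixes S :: "nat set"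
  assumes "numerical_semigroup S" and "S \<noteq> UNIV"
  shows "num_sets_of S \<ge> 2 ^ kappa S"
proof -
  let ?cc = "connected_components (GPF_verts S) (GPF_edges S)"
  let ?f = "\<lambda>K. pf_extension S (\<Union>K)"
  have nset: "numerical_set S"
    using assms by (simp add: numerical_semigroup_def)
  have verts: "\<Union>K \<subseteq> GPF_verts S" if "K \<subseteq> ?cc" for K
    using that by (fastforce simp: connected_components_def quotient_def)
  have "?f K \<in> numerical_sets_of S" if K: "K \<subseteq> ?cc" for K
  proof -
    have "atom_monoid (?f K) = S"
    proof (rule atom_monoid_pf_extension[OF assms verts[OF K]])
      show "Q \<in> \<Union>K" if "P \<in> \<Union>K" "(P, Q) \<in> GPF_edges S" for P Q
        using Union_connected_components_closed[OF K that] that(2)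
        by (simp add: GPF_edges_def)
    qed
    \<comment> \<open>Every gap of \<open>?f K\<close> is a gap of \<open>S\<close>, so there are
      finitely many.\<close>
    moreover have "numerical_set (?f K)"
      using nset pf_extension_superset[OF assms(1), of "\<Union>K"]
      by (auto simp: numerical_set_def intro: finite_subset[of _ "UNIV - S"])
    ultimately show ?thesis
      by (simp add: numerical_sets_of_def)
  qed
  then have image: "?f ` Pow ?cc \<subseteq> numerical_sets_of S"
    by blast
  have inj: "inj_on ?f (Pow ?cc)"
  proof (rule inj_onI)
    fix K L assume K: "K \<in> Pow ?cc" and L: "L \<in> Pow ?cc" and eq: "?f K = ?f L"
    \<comment> \<open>Intersecting with \<open>pseudo_frobenius S\<close> inverts
      \<open>pf_extension S\<close>; splitting the union into its classes then inverts
      \<open>Union\<close>.\<close>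
    have recover: "?f M \<inter> pseudo_frobenius S = \<Union>M" if "M \<in> Pow ?cc" for M
      using pf_extension_Int_pseudo_frobenius[OF nset] verts[of M] that
      by (auto simp: GPF_verts_def)
    have "\<Union>K = \<Union>L"
      by (metis recover[OF K] recover[OF L] eq)
    moreover have "inj_on Union (Pow ?cc)"
      unfolding connected_components_def
      by (intro inj_on_Union_quotient equiv_connected sym_GPF_edges)
    ultimately show "K = L"
      using K L by (auto dest: inj_onD)
  qed
  have "2 ^ kappa S = card (Pow ?cc)"
    using finite_connected_components[OF nset] by (simp add: kappa_def card_Pow)
  also have "\<dots> \<le> card (numerical_sets_of S)"
    using card_inj_on_le[OF inj image finite_numerical_sets_of[OF nset]] .
  finally show ?thesis
    by (simp add: num_sets_of_def)
qed

end
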